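(* Let $T\ge 1$, $n_x,n_u\ge 1$, $\bar A\in\mathbb{R}^{n_x\times n_x}$, $\bar B\in\mathbb{R}^{n_x\times n_u}$, $x_{init}\in\mathbb{R}^{n_x}$, $q_T\in\mathbb{R}^{n_x}$, let $Q_0,\dots,Q_T\in\mathbb{R}^{n_x\times n_x}$ and $R_0,\dots,R_{T-1}\in\mathbb{R}^{n_u\times n_u}$ be symmetric positive semidefinite, and let $\mathcal{U}_t\subseteq\mathbb{R}^{n_u}$ be input constraint sets (possibly composed wholly or in part of discrete-valued constraints). Consider the hybrid MPC problem $$\begin{aligned}\min\ & \sum_{t=0}^{T-1}\left(x_t^\top Q_t x_t+u_t^\top R_t u_t\right)+x_T^\top Q_T x_T+2q_T^\top x_T\\ \text{s.t. }\ & x_{t+1}=\bar A x_t+\bar B u_t,\quad x_0=x_{init},\quad u_t\in\mathcal{U}_t,\quad t=0,1,\dots,T-1,\end{aligned}$$ in the stacked variable $x=[x_0;\dots;x_T;u_0;\dots;u_{T-1}]\in\mathbb{R}^n$, $n=n_x(T+1)+n_uT$. If $\mathcal{U}_t$ is bounded for every $t=0,1,\dots,T-1$, then the optimization-based correction is applicable to this problem. That is, with $P$, $G$ and $I_{\mathcal B}$ the data matrices of the problem given in the context, the matrix $[P,\ I_{\mathcal B}^\top,\ G^\top]$ has rank $n$ (full row rank); equivalently, for every $r\in\mathbb{R}^n$ the linear system $$P\,\Delta x+I_{\mathcal B}^\top\,\Delta y_{\mathcal B}+G^\top\,\Delta z=-r$$ has a solution $(\Delta x,\Delta y_{\mathcal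 B},\Delta z)$.
   Context: General setting. A mixed integer conic program has the form: minimize $\frac12 x^\top P x+q^\top x$ subject to $Gx=h$, $Ax+s=b$, $s\in\mathcal K$, $\bar l\le x\le\bar u$, $x_{\mathbb I}\in\mathcal Z$, where $P\in\mathbb{R}^{n\times n}$ is symmetric positive semidefinite, $G\in\mathbb{R}^{p\times n}$, $A\in\mathbb{R}^{m\times n}$, $\mathcal K$ is a proper cone, $\mathcal Z$ is a finite integer set and $\mathbb I$ is the set of integer-constrained entries. Its continuous relaxations in branch-and-bound replace the integrality and box constraints by $l\le x\le u$ with $\bar l\le l\le u\le\bar u$. Let $\mathcal B\subseteq\{1,\dots,n\}$ be the set of entries of $x$ that have explicit finite bounds $l_{\mathcal B}\le x_{\mathcal B}\le u_{\mathcal B}$, and let $I_{\mathcal B}\in\mathbb{R}^{|\mathcal B|\times n}$ be the selection (incidence) matrix with $x_{\mathcal B}=I_{\mathcal B}x$. Optimization-based correction. Given a dual iterate of a primal-dual algorithm for the relaxation, whose dual linear equality constraint has residual $r\in\mathbb{R}^n$, a correction $(\Delta x,\Delta y_{\mathcal B},\Delta z)$ of the unconstrained dual variables is sought that removes the residual, i.e. that satisfies $P\Delta x+I_{\mathcal B}^\top\Delta y_{\mathcal B}+G^\top\Delta z=-r$, giving a dual feasible point. The correction is called applicable when the following assumption holds: $[P,I_{\mathcal B}^\top,G^\top]$ has rank $n$ (full row rank), so that such a correction exists for every residual. Data of the hybrid MPC problem. With $x=[x_0;\dots;x_T;u_0;\dots;u_{T-1}]$: - $P=2\,\mathrm{diag}(Q,R)$,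 where $Q=\mathrm{diag}(Q_0,\dots,Q_T)$ and $R=\mathrm{diag}(R_0,\dots,R_{T-1})$ are block diagonal. - $G\in\mathbb{R}^{n_x(T+1)\times n}$ is the matrix of the equality constraints $x_0=x_{init}$ and $\bar A x_t-x_{t+1}+\bar B u_t=0$, $t=0,\dots,T-1$, so its first block row is $[I,0,\dots,0]$ and the block row for $t$ has $\bar A$ in the $x_t$ block, $-I$ in the $x_{t+1}$ block, $\bar B$ in the $u_t$ block and zeros elsewhere. - Since each $\mathcal U_t$ is bounded, all components of the inputs $u_0,\dots,u_{T-1}$ have explicit finite bounds, and $\mathcal B$ is the set of the $n_uT$ entries of $x$ corresponding to the inputs; thus $I_{\mathcal B}=[\,0_{n_uT\times n_x(T+1)}\ \ I_{n_uT}\,]$. The states $x_t$ need not be bounded. *)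

theory Defs
  imports Complex_Main "Jordan_Normal_Form.DL_Rank"
begin

section \<open>Vectors and matrices\<close>

definition append_cols :: "'a :: zero mat \<Rightarrow> 'a mat \<Rightarrow> 'a mat" (infixr \<open>@\<^sub>c\<close> 65) where
  "A @\<^sub>c B = four_block_mat A B (0\<^sub>m 0 (dim_col A)) (0\<^sub>m 0 (dim_col B))"

definition block_mat :: "nat \<Rightarrow> nat \<Rightarrow> nat \<Rightarrow> nat \<Rightarrow> (nat \<Rightarrow> nat \<Rightarrow> 'a mat) \<Rightarrow> 'a mat" where
  "block_mat r c M N F = mat (r * M) (c * N) (\<lambda>(i, j). F (i div r) (j div c) $$ (i mod r, j mod c))"

definition stack_vec :: "nat \<Rightarrow> nat \<Rightarrow> (nat \<Rightarrow> 'a vec) \<Rightarrow> 'a vec" where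
  "stack_vec d N f = vec (d * N) (\<lambda>i. f (i div d) $ (i mod d))"

definition selection_mat :: "nat \<Rightarrow> nat set \<Rightarrow> 'a :: zero_neq_one mat" where
  "selection_mat n S = mat_of_rows n (map (unit_vec n) (sorted_list_of_set S))"

definition sym_psd :: "nat \<Rightarrow> real mat \<Rightarrow> bool" where
  "sym_psd n M \<longleftrightarrow> M \<in> carrier_mat n n \<and> transpose_mat M = M \<and>
     (\<forall>v \<in> carrier_vec n. 0 \<le> v \<bullet> (M *\<^sub>v v))"

text \<open>The type of vectors has no metric structure, so boundedness is stated with the Euclidean norm.\<close>

definition bounded_vecs :: "real vec set \<Rightarrow> bool" where
  "bounded_vecs S \<longleftrightarrow> (\<exists>c. \<forall>v \<in> S. sqrt (v \<bullet> v) \<le> c)"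

section \<open>Applicability of the optimization-based correction\<close>

definition correction_applicable :: "real mat \<Rightarrow> real mat \<Rightarrow> real mat \<Rightarrow> bool" where
  "correction_applicable P I\<^sub>B G \<longleftrightarrow>
     vec_space.rank (dim_row P) (P @\<^sub>c transpose_mat I\<^sub>B @\<^sub>c transpose_mat G) = dim_row P"

section \<open>The hybrid MPC problem\<close>

record hybrid_mpc =
  horizon :: nat
  n_x :: nat
  n_u :: nat
  A_bar :: "real mat"
  B_bar :: "real mat"
  x_init :: "real vec"
  q_term :: "real vec"
  Q_cost :: "nat \<Rightarrow> real mat"
  R_cost :: "nat \<Rightarrow> real mat"
  U_set :: "nat \<Rightarrow> real vec set"

definition is_hybrid_mpc :: "hybrid_mpc \<Rightarrow> bool" where
  "is_hybrid_mpc p \<longleftrightarrow>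
     1 \<le> horizon p \<and> 1 \<le> n_x p \<and> 1 \<le> n_u p \<and>
     A_bar p \<in> carrier_mat (n_x p) (n_x p) \<and>
     B_bar p \<in> carrier_mat (n_x p) (n_u p) \<and>
     x_init p \<in> carrier_vec (n_x p) \<and>
     q_term p \<in> carrier_vec (n_x p) \<and>
     (\<forall>t \<le> horizon p. sym_psd (n_x p) (Q_cost p t)) \<and>
     (\<forall>t < horizon p. sym_psd (n_u p) (R_cost p t)) \<and>
     (\<forall>t < horizon p. U_set p t \<subseteq> carrier_vec (n_u p))"

definition mpc_objective :: "hybrid_mpc \<Rightarrow> (nat \<Rightarrow> real vec) \<Rightarrow> (nat \<Rightarrow> real vec) \<Rightarrow> real" where
  "mpc_objective p x u =
     (\<Sum>t<horizon p. x t \<bullet> (Q_cost p t *\<^sub>v x t) + u t \<bullet> (R_cost p t *\<^sub>v u t))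
     + x (horizon p) \<bullet> (Q_cost p (horizon p) *\<^sub>v x (horizon p))
     + 2 * (q_term p \<bullet> x (horizon p))"

definition mpc_feasible :: "hybrid_mpc \<Rightarrow> (nat \<Rightarrow> real vec) \<Rightarrow> (nat \<Rightarrow> real vec) \<Rightarrow> bool" where
  "mpc_feasible p x u \<longleftrightarrow>
     x 0 = x_init p \<and>
     (\<forall>t < horizon p. x (Suc t) = A_bar p *\<^sub>v x t + B_bar p *\<^sub>v u t \<and> u t \<in> U_set p t)"

section \<open>Data of the problem in the stacked variable\<close>

definition mpc_dim :: "hybrid_mpc \<Rightarrow> nat" where
  "mpc_dim p = n_x p * (horizon p + 1) + n_u p * horizon p"

definition mpc_stack :: "hybrid_mpc \<Rightarrow> (nat \<Rightarrow> real vec) \<Rightarrow> (nat \<Rightarrow> real vec) \<Rightarrow> real vec" where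
  "mpc_stack p x u = stack_vec (n_x p) (horizon p + 1) x @\<^sub>v stack_vec (n_u p) (horizon p) u"

definition mpc_P :: "hybrid_mpc \<Rightarrow> real mat" where
  "mpc_P p = 2 \<cdot>\<^sub>m diag_block_mat
     [diag_block_mat (map (Q_cost p) [0..<horizon p + 1]),
      diag_block_mat (map (R_cost p) [0..<horizon p])]"

definition mpc_q :: "hybrid_mpc \<Rightarrow> real vec" where
  "mpc_q p = mpc_stack p
     (\<lambda>t. if t = horizon p then 2 \<cdot>\<^sub>v q_term p else 0\<^sub>v (n_x p)) (\<lambda>t. 0\<^sub>v (n_u p))"

text \<open>Block row 0 is the initial condition; block row \<open>t + 1\<close> is the dynamics at time \<open>t\<close>.\<close>

definition mpc_G :: "hybrid_mpc \<Rightarrow> real mat" where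
  "mpc_G p =
     block_mat (n_x p) (n_x p) (horizon p + 1) (horizon p + 1)
       (\<lambda>i s. if i = 0 then (if s = 0 then 1\<^sub>m (n_x p) else 0\<^sub>m (n_x p) (n_x p))
              else if s = i - 1 then A_bar p
              else if s = i then - 1\<^sub>m (n_x p)
              else 0\<^sub>m (n_x p) (n_x p))
     @\<^sub>c
     block_mat (n_x p) (n_u p) (horizon p + 1) (horizon p)
       (\<lambda>i s. if i \<noteq> 0 \<and> s = i - 1 then B_bar p else 0\<^sub>m (n_x p) (n_u p))"

definition mpc_h :: "hybrid_mpc \<Rightarrow> real vec" where
  "mpc_h p = stack_vec (n_x p) (horizon p + 1) (\<lambda>i. if i = 0 then x_init p else 0\<^sub>v (n_x p))"

text \<open>
  The (zero-based) positions in the stacked variable of those input components on which the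
  constraint \<open>u\<^sub>t \<in> U\<^sub>t\<close> imposes finite lower and upper bounds. The states carry no
  explicit bounds. If every \<open>U\<^sub>t\<close> is bounded, these are all the input positions and
  \<open>mpc_I p\<close> is \<open>[0 I]\<close>; see the lemmas at the end.
\<close>

definition mpc_bounded_entries :: "hybrid_mpc \<Rightarrow> nat set" where
  "mpc_bounded_entries p =
     {n_x p * (horizon p + 1) + (n_u p * t + j) | t j.
        t < horizon p \<and> j < n_u p \<and> (\<exists>l b. \<forall>v \<in> U_set p t. l \<le> v $ j \<and> v $ j \<le> b)}"

definition mpc_I :: "hybrid_mpc \<Rightarrow> real mat" where
  "mpc_I p = selection_mat (mpc_dim p) (mpc_bounded_entries p)"

section \<open>The data represent the problem\<close>

lemma stack_vec_carrier [simp]: "stack_vec d N f \<in> carrier_vec (d * N)"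
  by (simp add: stack_vec_def)

lemma block_mat_carrier [simp]: "block_mat r c M N F \<in> carrier_mat (r * M) (c * N)"
  by (simp add: block_mat_def)

lemma append_cols_carrier:
  assumes "A \<in> carrier_mat r c1" "B \<in> carrier_mat r c2"
  shows "A @\<^sub>c B \<in> carrier_mat r (c1 + c2)"
  using assms by (auto simp: append_cols_def)

lemma append_cols_mult_vec:
  fixes A B :: "'a :: comm_ring_1 mat"
  assumes "A \<in> carrier_mat r c1" "B \<in> carrier_mat r c2" "a \<in> carrier_vec c1" "b \<in> carrier_vec c2"
  shows "(A @\<^sub>c B) *\<^sub>v (a @\<^sub>v b) = A *\<^sub>v a + B *\<^sub>v b"
proof -
  have "(A @\<^sub>c B) *\<^sub>v (a @\<^sub>v b) = (A *\<^sub>v a + B *\<^sub>v b) @\<^sub>v (0\<^sub>m 0 c1 *\<^sub>v a + 0\<^sub>m 0 c2 *\<^sub>v b)"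
    unfolding append_cols_def using assms by (subst four_block_mat_mult_vec[of _ r c1 _ c2 _ 0]) auto
  then show ?thesis using assms by (auto intro!: eq_vecI)
qed

lemma stack_vec_Suc:
  assumes "f N \<in> carrier_vec d"
  shows "stack_vec d (Suc N) f = stack_vec d N f @\<^sub>v f N"
proof (rule eq_vecI)
  show "dim_vec (stack_vec d (Suc N) f) = dim_vec (stack_vec d N f @\<^sub>v f N)"
    using assms by (simp add: stack_vec_def)
next
  fix i assume "i < dim_vec (stack_vec d N f @\<^sub>v f N)"
  then have i: "i < d * N + d" using assms by (simp add: stack_vec_def)
  show "stack_vec d (Suc N) f $ i = (stack_vec d N f @\<^sub>v f N) $ i"
  proof (cases "i < d * N")
    case True then show ?thesis using i by (simp add: stack_vec_def)
  next
    case False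
    define k where "k = i - d * N"
    have k: "i = k + d * N" "k < d" using False i by (auto simp: k_def)
    then show ?thesis using assms by (simp add: stack_vec_def)
  qed
qed

lemma diag_block_carrier:
  assumes "\<And>t. t < N \<Longrightarrow> M t \<in> carrier_mat d d"
  shows "diag_block_mat (map M [0..<N]) \<in> carrier_mat (d * N) (d * N)"
proof -
  have "sum_list (map dim_row (map M [0..<N])) = d * N"
       "sum_list (map dim_col (map M [0..<N])) = d * N"
    using assms by (induct N) auto
  then show ?thesis by (auto simp: dim_diag_block_mat)
qed

lemma diag2_quad:
  fixes A B :: "'a :: comm_ring_1 mat"
  assumes "A \<in> carrier_mat n1 n1" "B \<in> carrier_mat n2 n2" "a \<in> carrier_vec n1" "b \<in> carrier_vec n2"
  shows "(a @\<^sub>v b) \<bullet> (four_block_mat A (0\<^sub>m n1 n2) (0\<^sub>m n2 n1) B *\<^sub>v (a @\<^sub>v b))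
    = a \<bullet> (A *\<^sub>v a) + b \<bullet> (B *\<^sub>v b)"
proof -
  have "four_block_mat A (0\<^sub>m n1 n2) (0\<^sub>m n2 n1) B *\<^sub>v (a @\<^sub>v b) = (A *\<^sub>v a) @\<^sub>v (B *\<^sub>v b)"
    using assms by (subst four_block_mat_mult_vec[of _ n1 n1 _ n2 _ n2]) auto
  then show ?thesis using assms by (simp add: scalar_prod_append[of _ n1 _ n2])
qed

lemma diag_block_quad:
  fixes M :: "nat \<Rightarrow> 'a :: comm_ring_1 mat"
  assumes "\<And>t. t < N \<Longrightarrow> M t \<in> carrier_mat d d" "\<And>t. t < N \<Longrightarrow> f t \<in> carrier_vec d"
  shows "stack_vec d N f \<bullet> (diag_block_mat (map M [0..<N]) *\<^sub>v stack_vec d N f)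
    = (\<Sum>t<N. f t \<bullet> (M t *\<^sub>v f t))"
  using assms
proof (induct N)
  case 0
  then show ?case by (simp add: stack_vec_def scalar_prod_def)
next
  case (Suc N)
  let ?D = "diag_block_mat (map M [0..<N])"
  have D: "?D \<in> carrier_mat (d * N) (d * N)" using Suc by (intro diag_block_carrier) auto
  have M: "M N \<in> carrier_mat d d" and f: "f N \<in> carrier_vec d" using Suc by auto
  have "diag_block_mat (map M [0..<Suc N])
      = four_block_mat ?D (0\<^sub>m (d * N) d) (0\<^sub>m d (d * N)) (M N)"
    using D M by (simp add: diag_block_mat_last Let_def)
  then show ?case
    using diag2_quad[OF D M _ f, of "stack_vec d N f"] Suc f by (simp add: stack_vec_Suc)
qed

lemma stack_vec_scalar_prod:
  fixes f g :: "nat \<Rightarrow> 'a :: comm_ring_1 vec"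
  assumes "\<And>t. t < N \<Longrightarrow> f t \<in> carrier_vec d" "\<And>t. t < N \<Longrightarrow> g t \<in> carrier_vec d"
  shows "stack_vec d N f \<bullet> stack_vec d N g = (\<Sum>t<N. f t \<bullet> g t)"
  using assms
proof (induct N)
  case 0
  then show ?case by (simp add: stack_vec_def scalar_prod_def)
next
  case (Suc N)
  then show ?case by (simp add: stack_vec_Suc scalar_prod_append[of _ "d * N" _ d])
qed

lemma smult_mat_quad:
  fixes A :: "'a :: comm_ring_1 mat"
  assumes "A \<in> carrier_mat n n" "v \<in> carrier_vec n"
  shows "v \<bullet> ((k \<cdot>\<^sub>m A) *\<^sub>v v) = k * (v \<bullet> (A *\<^sub>v v))"
proof -
  have "(k \<cdot>\<^sub>m A) *\<^sub>v v = k \<cdot>\<^sub>v (A *\<^sub>v v)"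
    using assms by (intro eq_vecI) (auto simp: scalar_prod_def sum_distrib_left mult.assoc intro!: sum.cong)
  then show ?thesis using assms by simp
qed

lemma mpc_cost_carrier:
  assumes "is_hybrid_mpc p"
  shows "diag_block_mat (map (Q_cost p) [0..<horizon p + 1])
      \<in> carrier_mat (n_x p * (horizon p + 1)) (n_x p * (horizon p + 1))"
    and "diag_block_mat (map (R_cost p) [0..<horizon p])
      \<in> carrier_mat (n_u p * horizon p) (n_u p * horizon p)"
proof -
  have "Q_cost p t \<in> carrier_mat (n_x p) (n_x p)" if "t < horizon p + 1" for t
    using assms that by (simp add: is_hybrid_mpc_def sym_psd_def)
  then show "diag_block_mat (map (Q_cost p) [0..<horizon p + 1])
      \<in> carrier_mat (n_x p * (horizon p + 1)) (n_x p * (horizon p + 1))"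
    by (rule diag_block_carrier)
  have "R_cost p t \<in> carrier_mat (n_u p) (n_u p)" if "t < horizon p" for t
    using assms that by (simp add: is_hybrid_mpc_def sym_psd_def)
  then show "diag_block_mat (map (R_cost p) [0..<horizon p])
      \<in> carrier_mat (n_u p * horizon p) (n_u p * horizon p)"
    by (rule diag_block_carrier)
qed

lemma mpc_P_carrier:
  assumes "is_hybrid_mpc p"
  shows "mpc_P p \<in> carrier_mat (mpc_dim p) (mpc_dim p)"
  using mpc_cost_carrier[OF assms]
  by (auto simp: mpc_P_def mpc_dim_def Let_def simp del: upt_Suc)

lemma mpc_objective_eq:
  assumes p: "is_hybrid_mpc p"
    and x: "\<And>t. t \<le> horizon p \<Longrightarrow> x t \<in> carrier_vec (n_x p)"
    and u: "\<And>t. t < horizon p \<Longrightarrow> u t \<in> carrier_vec (n_u p)"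
  shows "mpc_objective p x u =
    1 / 2 * (mpc_stack p x u \<bullet> (mpc_P p *\<^sub>v mpc_stack p x u)) + mpc_q p \<bullet> mpc_stack p x u"
proof -
  let ?T = "horizon p"
  let ?a = "n_x p * (?T + 1)" and ?b = "n_u p * ?T"
  let ?QQ = "diag_block_mat (map (Q_cost p) [0..<?T + 1])"
  let ?RR = "diag_block_mat (map (R_cost p) [0..<?T])"
  let ?D = "four_block_mat ?QQ (0\<^sub>m ?a ?b) (0\<^sub>m ?b ?a) ?RR"
  let ?x = "stack_vec (n_x p) (?T + 1) x" and ?u = "stack_vec (n_u p) ?T u"
  have Qc: "?QQ \<in> carrier_mat ?a ?a" and Rc: "?RR \<in> carrier_mat ?b ?b"
    using mpc_cost_carrier[OF p] by blast+
  have P: "mpc_P p = 2 \<cdot>\<^sub>m ?D"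
    using Qc Rc unfolding mpc_P_def diag_block_mat.simps(2)[of ?QQ] diag_block_mat_singleton Let_def
    by (simp del: upt_Suc)
  have D: "?D \<in> carrier_mat (?a + ?b) (?a + ?b)" using Qc Rc by auto
  have s: "mpc_stack p x u = ?x @\<^sub>v ?u" by (simp add: mpc_stack_def)
  have sc: "?x @\<^sub>v ?u \<in> carrier_vec (?a + ?b)"
    by (intro append_carrier_vec stack_vec_carrier)
  have "(?x @\<^sub>v ?u) \<bullet> (mpc_P p *\<^sub>v (?x @\<^sub>v ?u)) = 2 * ((?x @\<^sub>v ?u) \<bullet> (?D *\<^sub>v (?x @\<^sub>v ?u)))"
    unfolding P by (rule smult_mat_quad[OF D sc])
  also have "(?x @\<^sub>v ?u) \<bullet> (?D *\<^sub>v (?x @\<^sub>v ?u)) = ?x \<bullet> (?QQ *\<^sub>v ?x) + ?u \<bullet> (?RR *\<^sub>v ?u)"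
    by (rule diag2_quad[OF Qc Rc stack_vec_carrier stack_vec_carrier])
  also have "?x \<bullet> (?QQ *\<^sub>v ?x) = (\<Sum>t<?T + 1. x t \<bullet> (Q_cost p t *\<^sub>v x t))"
    using p x by (intro diag_block_quad) (auto simp: is_hybrid_mpc_def sym_psd_def)
  also have "?u \<bullet> (?RR *\<^sub>v ?u) = (\<Sum>t<?T. u t \<bullet> (R_cost p t *\<^sub>v u t))"
    using p u by (intro diag_block_quad) (auto simp: is_hybrid_mpc_def sym_psd_def)
  finally have quad: "(?x @\<^sub>v ?u) \<bullet> (mpc_P p *\<^sub>v (?x @\<^sub>v ?u)) =
    2 * ((\<Sum>t<?T + 1. x t \<bullet> (Q_cost p t *\<^sub>v x t)) + (\<Sum>t<?T. u t \<bullet> (R_cost p t *\<^sub>v u t)))" .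
  let ?q = "\<lambda>t. if t = ?T then 2 \<cdot>\<^sub>v q_term p else 0\<^sub>v (n_x p)"
  have qT: "q_term p \<in> carrier_vec (n_x p)" using p by (simp add: is_hybrid_mpc_def)
  have "mpc_q p \<bullet> (?x @\<^sub>v ?u) =
      stack_vec (n_x p) (?T + 1) ?q \<bullet> ?x + stack_vec (n_u p) ?T (\<lambda>t. 0\<^sub>v (n_u p)) \<bullet> ?u"
    unfolding mpc_q_def mpc_stack_def by (rule scalar_prod_append) (rule stack_vec_carrier)+
  also have "stack_vec (n_x p) (?T + 1) ?q \<bullet> ?x = (\<Sum>t<?T + 1. ?q t \<bullet> x t)"
    using x qT by (intro stack_vec_scalar_prod) auto
  also have "\<dots> = 2 * (q_term p \<bullet> x ?T)"
    using x[of ?T] x qT by simp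
  also have "stack_vec (n_u p) ?T (\<lambda>t. 0\<^sub>v (n_u p)) \<bullet> ?u = (\<Sum>t<?T. 0\<^sub>v (n_u p) \<bullet> u t)"
    using u by (intro stack_vec_scalar_prod) auto
  also have "\<dots> = 0" using u by simp
  finally show ?thesis
    unfolding s quad mpc_objective_def by (simp add: sum.distrib)
qed

lemma block_mat_mult_stack:
  fixes F :: "nat \<Rightarrow> nat \<Rightarrow> 'a :: comm_ring_1 mat"
  assumes F: "\<And>i s. i < M \<Longrightarrow> s < N \<Longrightarrow> F i s \<in> carrier_mat r c"
    and f: "\<And>s. s < N \<Longrightarrow> f s \<in> carrier_vec c"
    and k: "i < M" "k < r"
  shows "(block_mat r c M N F *\<^sub>v stack_vec c N f) $ (r * i + k) = (\<Sum>s<N. (F i s *\<^sub>v f s) $ k)"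
proof -
  have lt: "r * i + k < r * M"
  proof -
    have "r * i + k < r * Suc i" using k by simp
    also have "\<dots> \<le> r * M" using k by (intro mult_le_mono2) simp
    finally show ?thesis .
  qed
  have "(block_mat r c M N F *\<^sub>v stack_vec c N f) $ (r * i + k)
      = (\<Sum>j<N * c. F i (j div c) $$ (k, j mod c) * f (j div c) $ (j mod c))"
    using lt k
    by (auto simp: block_mat_def stack_vec_def scalar_prod_def mult.commute lessThan_atLeast0 intro!: sum.cong)
  also have "\<dots> = (\<Sum>s<N. \<Sum>j = s * c..<s * c + c. F i (j div c) $$ (k, j mod c) * f (j div c) $ (j mod c))"
    by (rule sum.nat_group[symmetric])
  also have "\<dots> = (\<Sum>s<N. (F i s *\<^sub>v f s) $ k)"
  proof (rule sum.cong[OF refl])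
    fix s assume "s \<in> {..<N}"
    then have s: "F i s \<in> carrier_mat r c" "f s \<in> carrier_vec c" using F f k by auto
    have "(\<Sum>j = s * c..<s * c + c. F i (j div c) $$ (k, j mod c) * f (j div c) $ (j mod c))
        = (\<Sum>l = 0..<c. F i ((l + s * c) div c) $$ (k, (l + s * c) mod c)
            * f ((l + s * c) div c) $ ((l + s * c) mod c))"
      using sum.shift_bounds_nat_ivl[of "\<lambda>j. F i (j div c) $$ (k, j mod c) * f (j div c) $ (j mod c)" 0 "s * c" c]
      by (simp add: add.commute)
    also have "\<dots> = (\<Sum>l = 0..<c. F i s $$ (k, l) * f s $ l)"
      by (intro sum.cong) auto
    also have "\<dots> = (F i s *\<^sub>v f s) $ k"
      using s k by (auto simp: scalar_prod_def intro!: sum.cong)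
    finally show "(\<Sum>j = s * c..<s * c + c. F i (j div c) $$ (k, j mod c) * f (j div c) $ (j mod c))
        = (F i s *\<^sub>v f s) $ k" .
  qed
  finally show ?thesis .
qed

lemma mpc_G_carrier:
  "mpc_G p \<in> carrier_mat (n_x p * (horizon p + 1)) (mpc_dim p)"
  unfolding mpc_G_def mpc_dim_def by (intro append_cols_carrier block_mat_carrier)

lemma mpc_G_mult_stack:
  assumes p: "is_hybrid_mpc p"
    and x: "\<And>t. t \<le> horizon p \<Longrightarrow> x t \<in> carrier_vec (n_x p)"
    and u: "\<And>t. t < horizon p \<Longrightarrow> u t \<in> carrier_vec (n_u p)"
    and i: "i < horizon p + 1" and k: "k < n_x p"
  shows "(mpc_G p *\<^sub>v mpc_stack p x u) $ (n_x p * i + k) =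
    (if i = 0 then x 0 $ k
     else (A_bar p *\<^sub>v x (i - 1)) $ k - x i $ k + (B_bar p *\<^sub>v u (i - 1)) $ k)"
proof -
  let ?T = "horizon p"
  let ?F = "\<lambda>i s. if i = 0 then (if s = 0 then 1\<^sub>m (n_x p) else 0\<^sub>m (n_x p) (n_x p))
              else if s = i - 1 then A_bar p
              else if s = i then - 1\<^sub>m (n_x p)
              else 0\<^sub>m (n_x p) (n_x p)"
  let ?H = "\<lambda>i s. if i \<noteq> 0 \<and> s = i - 1 then B_bar p else 0\<^sub>m (n_x p) (n_u p)"
  let ?GF = "block_mat (n_x p) (n_x p) (?T + 1) (?T + 1) ?F"
  let ?GH = "block_mat (n_x p) (n_u p) (?T + 1) ?T ?H"
  let ?x = "stack_vec (n_x p) (?T + 1) x" and ?u = "stack_vec (n_u p) ?T u"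
  have A: "A_bar p \<in> carrier_mat (n_x p) (n_x p)" and B: "B_bar p \<in> carrier_mat (n_x p) (n_u p)"
    using p by (auto simp: is_hybrid_mpc_def)
  have lt: "n_x p * i + k < n_x p * (?T + 1)"
  proof -
    have "n_x p * i + k < n_x p * Suc i" using k by simp
    also have "\<dots> \<le> n_x p * (?T + 1)" using i by (intro mult_le_mono2) simp
    finally show ?thesis .
  qed
  have "mpc_G p *\<^sub>v mpc_stack p x u = ?GF *\<^sub>v ?x + ?GH *\<^sub>v ?u"
    unfolding mpc_G_def mpc_stack_def
    by (rule append_cols_mult_vec) (rule block_mat_carrier stack_vec_carrier)+
  moreover have "dim_vec (?GH *\<^sub>v ?u) = n_x p * (?T + 1)" by (simp add: block_mat_def)
  ultimately have "(mpc_G p *\<^sub>v mpc_stack p x u) $ (n_x p * i + k)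
      = (?GF *\<^sub>v ?x) $ (n_x p * i + k) + (?GH *\<^sub>v ?u) $ (n_x p * i + k)"
    using lt by (simp del: dim_mult_mat_vec)
  also have "(?GF *\<^sub>v ?x) $ (n_x p * i + k) = (\<Sum>s<?T + 1. (?F i s *\<^sub>v x s) $ k)"
    using A x i k by (intro block_mat_mult_stack) auto
  also have "(?GH *\<^sub>v ?u) $ (n_x p * i + k) = (\<Sum>s<?T. (?H i s *\<^sub>v u s) $ k)"
    using B u i k by (intro block_mat_mult_stack) auto
  also have "(\<Sum>s<?T + 1. (?F i s *\<^sub>v x s) $ k) =
      (if i = 0 then x 0 $ k else (A_bar p *\<^sub>v x (i - 1)) $ k - x i $ k)"
  proof (cases "i = 0")
    case True
    have "(\<Sum>s<?T + 1. (?F i s *\<^sub>v x s) $ k) = (\<Sum>s<?T + 1. if s = 0 then x 0 $ k else 0)"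
      using True x k by (intro sum.cong) auto
    then show ?thesis using True by simp
  next
    case False
    have "dim_vec (x i) = n_x p" using x[of i] i by auto
    then have "(- 1\<^sub>m (n_x p) *\<^sub>v x i) $ k = - (x i $ k)" and "(- x i) $ k = - (x i $ k)"
      using x[of i] i k by auto
    then have "(\<Sum>s<?T + 1. (?F i s *\<^sub>v x s) $ k) = (\<Sum>s<?T + 1.
        (if s = i - 1 then (A_bar p *\<^sub>v x (i - 1)) $ k else 0) + (if s = i then - (x i $ k) else 0))"
      using False x k by (intro sum.cong) auto
    then show ?thesis using False i by (simp add: sum.distrib del: sum.lessThan_Suc)
  qed
  also have "(\<Sum>s<?T. (?H i s *\<^sub>v u s) $ k) =
      (\<Sum>s<?T. if s = i - 1 then (if i = 0 then 0 else (B_bar p *\<^sub>v u (i - 1)) $ k) else 0)"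
    using u k by (intro sum.cong) auto
  also have "\<dots> = (if i = 0 then 0 else (B_bar p *\<^sub>v u (i - 1)) $ k)"
    using i by auto
  finally show ?thesis by auto
qed

lemma mpc_feasible_iff:
  assumes p: "is_hybrid_mpc p"
    and x: "\<And>t. t \<le> horizon p \<Longrightarrow> x t \<in> carrier_vec (n_x p)"
    and u: "\<And>t. t < horizon p \<Longrightarrow> u t \<in> carrier_vec (n_u p)"
  shows "mpc_feasible p x u \<longleftrightarrow>
    mpc_G p *\<^sub>v mpc_stack p x u = mpc_h p \<and> (\<forall>t < horizon p. u t \<in> U_set p t)"
proof -
  let ?T = "horizon p" and ?L = "mpc_G p *\<^sub>v mpc_stack p x u"
  have A: "A_bar p \<in> carrier_mat (n_x p) (n_x p)" and B: "B_bar p \<in> carrier_mat (n_x p) (n_u p)"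
    and xi: "x_init p \<in> carrier_vec (n_x p)" and nx: "n_x p > 0"
    using p by (auto simp: is_hybrid_mpc_def)
  have lt: "n_x p * i + k < n_x p * (?T + 1)" if "i < ?T + 1" "k < n_x p" for i k
  proof -
    have "n_x p * i + k < n_x p * Suc i" using that by simp
    also have "\<dots> \<le> n_x p * (?T + 1)" using that by (intro mult_le_mono2) simp
    finally show ?thesis .
  qed
  have h: "mpc_h p $ (n_x p * i + k) = (if i = 0 then x_init p $ k else 0)"
    if "i < ?T + 1" "k < n_x p" for i k
    using lt[OF that] that by (simp add: mpc_h_def stack_vec_def)
  have dims: "dim_vec ?L = n_x p * (?T + 1)" "dim_vec (mpc_h p) = n_x p * (?T + 1)"
    using mpc_G_carrier[of p] by (auto simp: mpc_h_def stack_vec_def)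
  have "?L = mpc_h p \<longleftrightarrow>
      (\<forall>i < ?T + 1. \<forall>k < n_x p. ?L $ (n_x p * i + k) = mpc_h p $ (n_x p * i + k))"
  proof
    assume *: "\<forall>i < ?T + 1. \<forall>k < n_x p. ?L $ (n_x p * i + k) = mpc_h p $ (n_x p * i + k)"
    show "?L = mpc_h p"
    proof (rule eq_vecI)
      fix j assume "j < dim_vec (mpc_h p)"
      then have "j < (?T + 1) * n_x p" by (simp only: dims mult.commute)
      then have "j div n_x p < ?T + 1" "j mod n_x p < n_x p"
        using nx by (auto intro: less_mult_imp_div_less)
      with * have "?L $ (n_x p * (j div n_x p) + j mod n_x p)
          = mpc_h p $ (n_x p * (j div n_x p) + j mod n_x p)" by blast
      then show "?L $ j = mpc_h p $ j" by simp
    qed (simp only: dims)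
  qed simp
  also have "\<dots> \<longleftrightarrow> (\<forall>i < ?T + 1. if i = 0 then x 0 = x_init p
      else x i = A_bar p *\<^sub>v x (i - 1) + B_bar p *\<^sub>v u (i - 1))"
  proof (intro all_cong)
    fix i assume i: "i < ?T + 1"
    have "(\<forall>k < n_x p. ?L $ (n_x p * i + k) = mpc_h p $ (n_x p * i + k)) \<longleftrightarrow>
      (\<forall>k < n_x p. if i = 0 then x 0 $ k = x_init p $ k
        else x i $ k = (A_bar p *\<^sub>v x (i - 1)) $ k + (B_bar p *\<^sub>v u (i - 1)) $ k)"
      using i by (intro all_cong) (auto simp: h mpc_G_mult_stack[OF p x u])
    also have "\<dots> \<longleftrightarrow> (if i = 0 then x 0 = x_init p
      else x i = A_bar p *\<^sub>v x (i - 1) + B_bar p *\<^sub>v u (i - 1))"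
      using A B xi x[of i] i by (auto simp: vec_eq_iff simp del: index_mult_mat_vec)
    finally show "(\<forall>k < n_x p. ?L $ (n_x p * i + k) = mpc_h p $ (n_x p * i + k)) \<longleftrightarrow> \<dots>" .
  qed
  also have "\<dots> \<longleftrightarrow> x 0 = x_init p \<and>
      (\<forall>t < ?T. x (Suc t) = A_bar p *\<^sub>v x t + B_bar p *\<^sub>v u t)"
    by (auto simp: less_Suc_eq_0_disj)
  finally show ?thesis unfolding mpc_feasible_def by auto
qed

section \<open>The bounded entries\<close>

lemma mpc_bounded_entries_eq:
  assumes p: "is_hybrid_mpc p" and b: "\<forall>t < horizon p. bounded_vecs (U_set p t)"
  shows "mpc_bounded_entries p = {n_x p * (horizon p + 1)..<mpc_dim p}"
proof -
  have bd: "\<exists>l b. \<forall>v \<in> U_set p t. l \<le> v $ j \<and> v $ j \<le> b" if t: "t < horizon p" and j: "j < n_u p" for t j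
  proof -
    obtain c where c: "\<And>v. v \<in> U_set p t \<Longrightarrow> sqrt (v \<bullet> v) \<le> c"
      using b t unfolding bounded_vecs_def by blast
    have "\<bar>v $ j\<bar> \<le> c" if v: "v \<in> U_set p t" for v
    proof -
      have "U_set p t \<subseteq> carrier_vec (n_u p)" using p t by (simp add: is_hybrid_mpc_def)
      with v have d: "dim_vec v = n_u p" by auto
      have "(v $ j)\<^sup>2 \<le> (\<Sum>i\<in>{0..<n_u p}. (v $ i)\<^sup>2)"
        using j by (intro member_le_sum) auto
      also have "\<dots> = v \<bullet> v" by (simp add: scalar_prod_def d power2_eq_square)
      finally have "\<bar>v $ j\<bar> \<le> sqrt (v \<bullet> v)" by (rule real_le_rsqrt[of "\<bar>v $ j\<bar>", simplified])
      with c[OF v] show ?thesis by simp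
    qed
    then have "\<forall>v \<in> U_set p t. - c \<le> v $ j \<and> v $ j \<le> c" by (simp add: abs_le_iff minus_le_iff)
    then show ?thesis by blast
  qed
  show ?thesis
  proof (intro equalityI subsetI)
    fix i assume "i \<in> mpc_bounded_entries p"
    then obtain t j where i: "i = n_x p * (horizon p + 1) + (n_u p * t + j)" "t < horizon p" "j < n_u p"
      by (auto simp: mpc_bounded_entries_def)
    have "n_u p * t + j < n_u p * Suc t" using i by simp
    also have "\<dots> \<le> n_u p * horizon p" using i by (intro mult_le_mono2) simp
    finally show "i \<in> {n_x p * (horizon p + 1)..<mpc_dim p}" using i by (simp add: mpc_dim_def)
  next
    fix i assume i: "i \<in> {n_x p * (horizon p + 1)..<mpc_dim p}"
    define k where "k = i - n_x p * (horizon p + 1)"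
    have k: "i = n_x p * (horizon p + 1) + k" "k < horizon p * n_u p"
      using i by (auto simp: k_def mpc_dim_def mult.commute)
    have t: "k div n_u p < horizon p" using k(2) by (rule less_mult_imp_div_less)
    have j: "k mod n_u p < n_u p" using p by (auto simp: is_hybrid_mpc_def)
    show "i \<in> mpc_bounded_entries p"
      unfolding mpc_bounded_entries_def
    proof (rule CollectI, rule exI[of _ "k div n_u p"], rule exI[of _ "k mod n_u p"], intro conjI)
      show "i = n_x p * (horizon p + 1) + (n_u p * (k div n_u p) + k mod n_u p)"
        using k(1) by simp
    qed (rule t j bd[OF t j])+
  qed
qed

lemma mpc_I_eq:
  assumes p: "is_hybrid_mpc p" and b: "\<forall>t < horizon p. bounded_vecs (U_set p t)"
  shows "mpc_I p =
    0\<^sub>m (n_u p * horizon p) (n_x p * (horizon p + 1)) @\<^sub>c 1\<^sub>m (n_u p * horizon p)"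
  unfolding mpc_I_def selection_mat_def mpc_bounded_entries_eq[OF p b] sorted_list_of_set_range
  by (intro eq_matI) (auto simp: append_cols_def mpc_dim_def mat_of_rows_def)

end

theory Submission
  imports Defs
begin

text \<open>
  The theorem reduces to a uniqueness question. The transposed system
  \<open>I\<^sub>B\<^sup>T y + G\<^sup>T z = r\<close> is solvable for every \<open>r\<close> as soon as \<open>I\<^sub>B\<close> and \<open>G\<close> have no common
  kernel vector except zero (lemma \<open>transposed_system_solvable\<close>). A common kernel vector is a
  trajectory of the dynamics that starts at \<open>x\<^sub>0 = 0\<close> (first block row of \<open>G\<close>), obeys the
  recursion \<open>x\<^sub>t\<^sub>+\<^sub>1 = A x\<^sub>t + B u\<^sub>t\<close> (remaining block rows of \<open>G\<close>), and has all inputs equal to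
  zero (\<open>I\<^sub>B\<close> selects every input because the input sets are bounded). Such a trajectory
  vanishes identically (lemma \<open>mpc_trivial_common_kernel\<close>): once the inputs are fixed, the
  states are determined by forward simulation.

  The columns of \<open>I\<^sub>B\<^sup>T\<close> and \<open>G\<^sup>T\<close> alone therefore span the whole space. The correction can be
  chosen with \<open>\<Delta>x = 0\<close>, and full row rank of \<open>[P, I\<^sub>B\<^sup>T, G\<^sup>T]\<close> follows.
\<close>

lemma scalar_prod_self_real:
  fixes v :: "real vec"
  assumes "v \<in> carrier_vec n"
  shows "0 \<le> v \<bullet> v" and "v \<bullet> v = 0 \<longleftrightarrow> v = 0\<^sub>v n"
proof -
  have "conjugate v = v" by (rule eq_vecI) auto
  then show "v \<bullet> v = 0 \<longleftrightarrow> v = 0\<^sub>v n"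
    using conjugate_square_eq_0_vec[OF assms] by simp
  show "0 \<le> v \<bullet> v" by (auto simp: scalar_prod_def intro!: sum_nonneg)
qed

text \<open>
  The Gram matrix \<open>K = E\<^sup>T E + G\<^sup>T G\<close> satisfies \<open>w \<bullet> K w = \<parallel>E w\<parallel>\<^sup>2 + \<parallel>G w\<parallel>\<^sup>2\<close>, so a trivial
  common kernel makes it invertible. If \<open>K v = r\<close>, then \<open>y = E v\<close> and \<open>z = G v\<close> solve the system.
\<close>

lemma transposed_system_solvable:
  fixes E G :: "real mat"
  assumes E: "E \<in> carrier_mat a n" and G: "G \<in> carrier_mat b n"
    and ker: "\<And>w. w \<in> carrier_vec n \<Longrightarrow> E *\<^sub>v w = 0\<^sub>v a \<Longrightarrow> G *\<^sub>v w = 0\<^sub>v b \<Longrightarrow> w = 0\<^sub>v n"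
    and r: "r \<in> carrier_vec n"
  shows "\<exists>y \<in> carrier_vec a. \<exists>z \<in> carrier_vec b.
    transpose_mat E *\<^sub>v y + transpose_mat G *\<^sub>v z = r"
proof -
  let ?K = "transpose_mat E * E + transpose_mat G * G"
  have K: "?K \<in> carrier_mat n n" using E G by auto
  have Kv: "?K *\<^sub>v w = transpose_mat E *\<^sub>v (E *\<^sub>v w) + transpose_mat G *\<^sub>v (G *\<^sub>v w)"
    if w: "w \<in> carrier_vec n" for w
  proof -
    have "?K *\<^sub>v w = transpose_mat E * E *\<^sub>v w + transpose_mat G * G *\<^sub>v w"
      using E G w by (intro add_mult_distrib_mat_vec[of _ n n]) auto
    also have "transpose_mat E * E *\<^sub>v w = transpose_mat E *\<^sub>v (E *\<^sub>v w)"
      using E w by (intro assoc_mult_mat_vec[of _ n a _ n]) auto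
    also have "transpose_mat G * G *\<^sub>v w = transpose_mat G *\<^sub>v (G *\<^sub>v w)"
      using G w by (intro assoc_mult_mat_vec[of _ n b _ n]) auto
    finally show ?thesis .
  qed
  have "det ?K \<noteq> 0"
  proof
    assume "det ?K = 0"
    then obtain w where w: "w \<in> carrier_vec n" "w \<noteq> 0\<^sub>v n" "?K *\<^sub>v w = 0\<^sub>v n"
      using det_0_iff_vec_prod_zero_field[OF K] by blast
    have Ew: "E *\<^sub>v w \<in> carrier_vec a" and Gw: "G *\<^sub>v w \<in> carrier_vec b" using E G w by auto
    have "0 = (?K *\<^sub>v w) \<bullet> w" using w by simp
    also have "\<dots> = (transpose_mat E *\<^sub>v (E *\<^sub>v w)) \<bullet> w + (transpose_mat G *\<^sub>v (G *\<^sub>v w)) \<bullet> w"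
      unfolding Kv[OF w(1)] using E G w Ew Gw by (intro add_scalar_prod_distrib[of _ n]) auto
    also have "\<dots> = (E *\<^sub>v w) \<bullet> (E *\<^sub>v w) + (G *\<^sub>v w) \<bullet> (G *\<^sub>v w)"
      using transpose_vec_mult_scalar[OF E w(1) Ew] transpose_vec_mult_scalar[OF G w(1) Gw] by simp
    finally have "(E *\<^sub>v w) \<bullet> (E *\<^sub>v w) = 0 \<and> (G *\<^sub>v w) \<bullet> (G *\<^sub>v w) = 0"
      using scalar_prod_self_real(1)[OF Ew] scalar_prod_self_real(1)[OF Gw] by linarith
    then have "w = 0\<^sub>v n"
      using ker[OF w(1)] scalar_prod_self_real(2)[OF Ew] scalar_prod_self_real(2)[OF Gw] by blast
    with w(2) show False by contradiction
  qed
  then obtain L where L: "L \<in> carrier_mat n n" "?K * L = 1\<^sub>m n"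
    using det_non_zero_imp_unit[OF K, of "()"] by (auto simp: Units_def ring_mat_def)
  define v where "v = L *\<^sub>v r"
  have v: "v \<in> carrier_vec n" using L r by (auto simp: v_def)
  have "?K *\<^sub>v v = (?K * L) *\<^sub>v r"
    unfolding v_def using K L r by (intro assoc_mult_mat_vec[symmetric]) auto
  then have "transpose_mat E *\<^sub>v (E *\<^sub>v v) + transpose_mat G *\<^sub>v (G *\<^sub>v v) = r"
    using Kv[OF v] L r by simp
  then show ?thesis
    using mult_mat_vec_carrier[OF E v] mult_mat_vec_carrier[OF G v] by blast
qed

lemma rank_eq_if_surj:
  fixes M :: "'a :: field mat"
  assumes M: "M \<in> carrier_mat n c"
    and surj: "\<And>r. r \<in> carrier_vec n \<Longrightarrow> \<exists>y \<in> carrier_vec c. M *\<^sub>v y = r"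
  shows "vec_space.rank n M = n"
proof -
  interpret vec_space "TYPE('a)" n .
  have "span (set (cols M)) = carrier_vec n"
    using col_space_eq[OF M] M surj unfolding col_space_def by auto
  moreover have "vs (carrier_vec n) = V" by (simp add: module_vec_def)
  ultimately show ?thesis by (simp only: rank_def dim_is_n)
qed

lemma stack_vec_blocks:
  assumes "w \<in> carrier_vec (d * N)"
  shows "w = stack_vec d N (\<lambda>t. vec d (\<lambda>k. w $ (d * t + k)))"
proof (rule eq_vecI)
  fix i assume "i < dim_vec (stack_vec d N (\<lambda>t. vec d (\<lambda>k. w $ (d * t + k))))"
  then have i: "i < d * N" by (simp add: stack_vec_def)
  then have "i mod d < d" by (cases "d = 0") auto
  with i show "w $ i = stack_vec d N (\<lambda>t. vec d (\<lambda>k. w $ (d * t + k))) $ i"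
    by (simp add: stack_vec_def)
qed (use assms in \<open>simp add: stack_vec_def\<close>)

lemma stack_vec_zero:
  assumes "\<And>t. t < N \<Longrightarrow> f t = 0\<^sub>v d"
  shows "stack_vec d N f = 0\<^sub>v (d * N)"
proof (rule eq_vecI)
  fix i assume "i < dim_vec (0\<^sub>v (d * N))"
  then have i: "i < N * d" by (simp add: mult.commute)
  then have "i mod d < d" by (cases "d = 0") auto
  with i show "stack_vec d N f $ i = 0\<^sub>v (d * N) $ i"
    using assms[OF less_mult_imp_div_less[OF i]] by (simp add: stack_vec_def mult.commute)
qed (simp add: stack_vec_def)

lemma mpc_I_mult_append:
  assumes "is_hybrid_mpc p" and "\<forall>t < horizon p. bounded_vecs (U_set p t)"
    and a: "a \<in> carrier_vec (n_x p * (horizon p + 1))" and b: "b \<in> carrier_vec (n_u p * horizon p)"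
  shows "mpc_I p *\<^sub>v (a @\<^sub>v b) = b"
proof -
  have "mpc_I p *\<^sub>v (a @\<^sub>v b)
      = 0\<^sub>m (n_u p * horizon p) (n_x p * (horizon p + 1)) *\<^sub>v a + 1\<^sub>m (n_u p * horizon p) *\<^sub>v b"
    unfolding mpc_I_eq[OF assms(1,2)] by (rule append_cols_mult_vec) (use a b in auto)
  also have "0\<^sub>m (n_u p * horizon p) (n_x p * (horizon p + 1)) *\<^sub>v a = 0\<^sub>v (n_u p * horizon p)"
    using a by (intro eq_vecI) (auto simp del: mult_Suc_right)
  finally show ?thesis using b by simp
qed

text \<open>
  A kernel vector of \<open>mpc_I p\<close> has zero input part, so it is a stacked state trajectory with
  zero inputs; the block rows of \<open>mpc_G p\<close> then make the states vanish by induction on time.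
\<close>

lemma mpc_trivial_common_kernel:
  assumes p: "is_hybrid_mpc p" and bd: "\<forall>t < horizon p. bounded_vecs (U_set p t)"
    and w: "w \<in> carrier_vec (mpc_dim p)"
    and Iw: "mpc_I p *\<^sub>v w = 0\<^sub>v (n_u p * horizon p)"
    and Gw: "mpc_G p *\<^sub>v w = 0\<^sub>v (n_x p * (horizon p + 1))"
  shows "w = 0\<^sub>v (mpc_dim p)"
proof -
  let ?T = "horizon p"
  let ?a = "n_x p * (?T + 1)" and ?b = "n_u p * ?T"
  define a where "a = vec_first w ?a"
  define b where "b = vec_last w ?b"
  define x where "x t = vec (n_x p) (\<lambda>k. a $ (n_x p * t + k))" for t
  define u :: "nat \<Rightarrow> real vec" where "u t = 0\<^sub>v (n_u p)" for t
  have ab: "a \<in> carrier_vec ?a" "b \<in> carrier_vec ?b" by (simp_all add: a_def b_def)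
  have w_ab: "w = a @\<^sub>v b" using w by (simp add: a_def b_def mpc_dim_def)
  have b0: "b = 0\<^sub>v ?b" using mpc_I_mult_append[OF p bd ab] Iw by (simp add: w_ab)
  have a_x: "a = stack_vec (n_x p) (?T + 1) x"
    using stack_vec_blocks[OF ab(1)] by (simp add: x_def[abs_def])
  have w_xu: "w = mpc_stack p x u"
    unfolding w_ab b0 mpc_stack_def a_x by (simp add: stack_vec_zero u_def)
  have xc: "x t \<in> carrier_vec (n_x p)" for t by (simp add: x_def)
  have A: "A_bar p \<in> carrier_mat (n_x p) (n_x p)" and B: "B_bar p \<in> carrier_mat (n_x p) (n_u p)"
    using p by (auto simp: is_hybrid_mpc_def)
  have row: "(if i = 0 then x 0 $ k
      else (A_bar p *\<^sub>v x (i - 1)) $ k - x i $ k + (B_bar p *\<^sub>v u (i - 1)) $ k) = 0"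
    if i: "i < ?T + 1" and k: "k < n_x p" for i k
  proof -
    have "n_x p * i + k < n_x p * Suc i" using k by simp
    also have "\<dots> \<le> ?a" using i by (intro mult_le_mono2) simp
    finally have "(mpc_G p *\<^sub>v mpc_stack p x u) $ (n_x p * i + k) = 0"
      using Gw by (simp add: w_xu)
    then show ?thesis
      using mpc_G_mult_stack[OF p, of x u i k] xc i k by (simp add: u_def)
  qed
  have "x t = 0\<^sub>v (n_x p)" if "t < ?T + 1" for t
    using that
  proof (induction t)
    case 0
    show ?case using row[of 0] xc[of 0] by (intro eq_vecI) auto
  next
    case (Suc t)
    then have "A_bar p *\<^sub>v x t = 0\<^sub>v (n_x p)" "B_bar p *\<^sub>v u t = 0\<^sub>v (n_x p)"
      using A B by (auto simp: u_def)
    then show ?case using row[OF Suc.prems] xc[of "Suc t"]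
      by (intro eq_vecI) auto
  qed
  then have "a = 0\<^sub>v ?a" unfolding a_x by (intro stack_vec_zero)
  then show ?thesis unfolding w_ab b0 by (auto simp: mpc_dim_def)
qed

theorem mainTheorem1:
  fixes p :: hybrid_mpc
  assumes "is_hybrid_mpc p"
    and "\<forall>t < horizon p. bounded_vecs (U_set p t)"
  shows "correction_applicable (mpc_P p) (mpc_I p) (mpc_G p) \<and>
    (\<forall>r \<in> carrier_vec (mpc_dim p).
       \<exists>dx \<in> carrier_vec (mpc_dim p).
       \<exists>dy \<in> carrier_vec (card (mpc_bounded_entries p)).
       \<exists>dz \<in> carrier_vec (n_x p * (horizon p + 1)).
         mpc_P p *\<^sub>v dx + transpose_mat (mpc_I p) *\<^sub>v dy + transpose_mat (mpc_G p) *\<^sub>v dz = - r)"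
proof -
  let ?n = "mpc_dim p" and ?m = "n_u p * horizon p" and ?k = "n_x p * (horizon p + 1)"
  let ?It = "transpose_mat (mpc_I p)" and ?Gt = "transpose_mat (mpc_G p)"
  have card: "card (mpc_bounded_entries p) = ?m"
    unfolding mpc_bounded_entries_eq[OF assms] by (simp add: mpc_dim_def)
  have P: "mpc_P p \<in> carrier_mat ?n ?n" by (rule mpc_P_carrier[OF assms(1)])
  have I: "mpc_I p \<in> carrier_mat ?m ?n"
    unfolding mpc_I_eq[OF assms] by (auto simp: append_cols_def mpc_dim_def)
  have G: "mpc_G p \<in> carrier_mat ?k ?n" by (rule mpc_G_carrier)
  have It: "?It \<in> carrier_mat ?n ?m" and Gt: "?Gt \<in> carrier_mat ?n ?k" using I G by auto
  have P0: "mpc_P p *\<^sub>v 0\<^sub>v ?n = 0\<^sub>v ?n" using P by auto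
  have sol: "\<exists>y \<in> carrier_vec ?m. \<exists>z \<in> carrier_vec ?k. ?It *\<^sub>v y + ?Gt *\<^sub>v z = r"
    if "r \<in> carrier_vec ?n" for r
    using transposed_system_solvable[OF I G mpc_trivial_common_kernel[OF assms] that] .
  have IG: "?It @\<^sub>c ?Gt \<in> carrier_mat ?n (?m + ?k)" by (rule append_cols_carrier[OF It Gt])
  have "vec_space.rank ?n (mpc_P p @\<^sub>c ?It @\<^sub>c ?Gt) = ?n"
  proof (rule rank_eq_if_surj[OF append_cols_carrier[OF P IG]])
    fix r :: "real vec" assume r: "r \<in> carrier_vec ?n"
    obtain y z where yz: "y \<in> carrier_vec ?m" "z \<in> carrier_vec ?k" "?It *\<^sub>v y + ?Gt *\<^sub>v z = r"
      using sol[OF r] by blast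
    have "(mpc_P p @\<^sub>c ?It @\<^sub>c ?Gt) *\<^sub>v (0\<^sub>v ?n @\<^sub>v (y @\<^sub>v z)) = r"
      using append_cols_mult_vec[OF P IG, of "0\<^sub>v ?n" "y @\<^sub>v z"]
        append_cols_mult_vec[OF It Gt yz(1,2)] P0 yz r by simp
    then show "\<exists>v \<in> carrier_vec (?n + (?m + ?k)). (mpc_P p @\<^sub>c ?It @\<^sub>c ?Gt) *\<^sub>v v = r"
      using yz by (intro bexI[of _ "0\<^sub>v ?n @\<^sub>v (y @\<^sub>v z)"]) auto
  qed
  then have "correction_applicable (mpc_P p) (mpc_I p) (mpc_G p)"
    using P by (simp add: correction_applicable_def)
  moreover have "\<exists>dx \<in> carrier_vec ?n. \<exists>dy \<in> carrier_vec ?m. \<exists>dz \<in> carrier_vec ?k.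
      mpc_P p *\<^sub>v dx + ?It *\<^sub>v dy + ?Gt *\<^sub>v dz = - r" if r: "r \<in> carrier_vec ?n" for r
  proof -
    obtain y z where yz: "y \<in> carrier_vec ?m" "z \<in> carrier_vec ?k" "?It *\<^sub>v y + ?Gt *\<^sub>v z = - r"
      using sol[of "- r"] r by auto
    have "?It *\<^sub>v y \<in> carrier_vec ?n" using It yz(1) by (rule mult_mat_vec_carrier)
    then have "mpc_P p *\<^sub>v 0\<^sub>v ?n + ?It *\<^sub>v y + ?Gt *\<^sub>v z = - r" using P0 yz by simp
    then show ?thesis using yz(1,2) zero_carrier_vec by blast
  qed
  ultimately show ?thesis unfolding card by blast
qed

end
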